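(* Let $a_1,\ldots,a_m$ ($m\ge1$) be nonzero integers, let $r=[2a_1,2a_2,\ldots,2a_m]$, and let $K(r)$ be the corresponding two-bridge knot (or two-component two-bridge link). If $a_ia_{i+1}<0$ for $i=1,2,\ldots,m-1$, then all zeros of the Alexander polynomial $\Delta_{K(r)}(t)$ are real and positive; hence every zero $\alpha$ satisfies $\operatorname{Re}(\alpha)>-1$.
   Context: For nonzero integers $a_1,\ldots,a_m$, the notation $[2a_1,\ldots,2a_m]$ denotes the even negative continued fraction $$[2a_1,2a_2,\ldots,2a_m]:=\cfrac{1}{2a_1-\cfrac{1}{2a_2-\cfrac{1}{\ddots-\cfrac{1}{2a_m}}}}.$$ $K(r)$ denotes the two-bridge knot ($m$ even) or two-component two-bridge link ($m$ odd) identified by the rational number $r$. The expansion gives a diagram of $K(r)$ and a minimal genus Seifert surface whose Seifert matrix is the $m\times m$ matrix $U=(u_{ij})$ with $u_{ii}=a_i$ for all $i$; $u_{i,i-1}=-1$ for every even $i$ with $2\le i\le m$; $u_{i,i+1}=1$ for every even $i$ with $i+1\le m$; and all other entries $0$. The Alexander polynomial is $\Delta_{K(r)}(t)=\det(tU-U^T)$ with this $U$. *)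

theory Defs
  imports Complex_Main "Jordan_Normal_Form.Determinant"
begin

text \<open>The value \<open>0\<close> on the empty list makes \<open>[2a\<^sub>m]\<close> equal to \<open>1/(2a\<^sub>m)\<close>.\<close>

fun even_ncf :: "int list \<Rightarrow> rat" where
  "even_ncf [] = 0"
| "even_ncf (c # cs) = 1 / (2 * of_int c - even_ncf cs)"

definition is_even_expansion :: "int list \<Rightarrow> rat \<Rightarrow> bool" where
  "is_even_expansion a r \<longleftrightarrow> a \<noteq> [] \<and> 0 \<notin> set a \<and> even_ncf a = r"

text \<open>With nonzero entries every denominator has absolute value above 1, so no division
  by zero occurs, and the entries can be recovered from the value of the fraction.\<close>

lemma abs_even_ncf_less_1:
  assumes "0 \<notin> set a"
  shows "\<bar>even_ncf a\<bar> < 1"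
  using assms
proof (induction a)
  case Nil
  then show ?case by simp
next
  case (Cons c cs)
  have x: "\<bar>even_ncf cs\<bar> < 1" using Cons by simp
  have "1 \<le> \<bar>c\<bar>" using Cons.prems by auto
  then have "(1::rat) \<le> \<bar>of_int c\<bar>" by linarith
  then have "1 < \<bar>2 * of_int c - even_ncf cs\<bar>" using x by linarith
  then show ?case by (simp add: abs_divide divide_simps)
qed

lemma even_ncf_denominator:
  assumes "0 \<notin> set (c # cs)"
  shows "1 < \<bar>2 * of_int c - even_ncf cs\<bar>"
proof -
  have x: "\<bar>even_ncf cs\<bar> < 1" using assms abs_even_ncf_less_1 by simp
  have "1 \<le> \<bar>c\<bar>" using assms by auto
  then have "(1::rat) \<le> \<bar>of_int c\<bar>" by linarith
  then show ?thesis using x by linarith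
qed

lemma even_ncf_inject:
  assumes "0 \<notin> set a" "0 \<notin> set b" "even_ncf a = even_ncf b"
  shows "a = b"
  using assms
proof (induction a arbitrary: b)
  case Nil
  then show ?case
    using even_ncf_denominator by (cases b) fastforce+
next
  case (Cons c cs)
  have dc: "1 < \<bar>2 * of_int c - even_ncf cs\<bar>"
    using Cons.prems even_ncf_denominator by blast
  show ?case
  proof (cases b)
    case Nil
    then show ?thesis using Cons.prems dc by auto
  next
    case b: (Cons d ds)
    have eq: "2 * of_int c - even_ncf cs = 2 * of_int d - even_ncf ds"
      using Cons.prems(3) b by (simp add: divide_inverse)
    have "\<bar>even_ncf cs\<bar> < 1" "\<bar>even_ncf ds\<bar> < 1"
      using Cons.prems b abs_even_ncf_less_1 by auto
    then have "\<bar>of_int (c - d) :: rat\<bar> < 1" using eq by (simp only: of_int_diff)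
    then have "c = d" by linarith
    then show ?thesis using Cons b eq by auto
  qed
qed

lemma is_even_expansion_unique:
  "is_even_expansion a r \<Longrightarrow> is_even_expansion b r \<Longrightarrow> a = b"
  using even_ncf_inject unfolding is_even_expansion_def by metis

definition even_expansion :: "rat \<Rightarrow> int list" where
  "even_expansion r = (THE a. is_even_expansion a r)"

lemma even_expansion_eq: "is_even_expansion a r \<Longrightarrow> even_expansion r = a"
  unfolding even_expansion_def using is_even_expansion_unique by blast

text \<open>Row and column numbers \<open>i\<close>, \<open>j\<close> start at 1, while list and matrix indices start at 0.\<close>

definition seifert_entry :: "int list \<Rightarrow> nat \<Rightarrow> nat \<Rightarrow> int" where
  "seifert_entry a i j =
    (if j = i then a ! (i - 1)
     else if even i \<and> Suc j = i then -1
     else if even i \<and> j = Suc i then 1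
     else 0)"

definition seifert_matrix :: "int list \<Rightarrow> int mat" where
  "seifert_matrix a =
    mat (length a) (length a) (\<lambda>(i, j). seifert_entry a (Suc i) (Suc j))"

definition seifert_alexander :: "int mat \<Rightarrow> int poly" where
  "seifert_alexander U =
    (let V = map_mat (\<lambda>c. [:c:]) U in det ([:0, 1:] \<cdot>\<^sub>m V - transpose_mat V))"

text \<open>The Alexander polynomial of the two-bridge knot or link \<open>K(r)\<close>, which enters only
  through the Seifert surface given by the (unique) even expansion of \<open>r\<close>. The value is
  meaningful only if \<open>r\<close> has such an expansion.\<close>

definition two_bridge_alexander :: "rat \<Rightarrow> int poly" where
  "two_bridge_alexander r = seifert_alexander (seifert_matrix (even_expansion r))"

end

theory Submission
  imports Defs "Jordan_Normal_Form.Char_Poly"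
begin

text \<open>At a zero \<open>t\<close>, the matrix \<open>tU - U\<^sup>T\<close> has a kernel vector \<open>v\<close>. Off the diagonal, \<open>U\<close> is nonzero
  only in even rows and odd columns, and the diagonal entries change sign with the parity. So, after
  a change of signs, the kernel equations read \<open>(t - 1) A x = W y\<close> and \<open>(t - 1) B y = t W\<^sup>T x\<close>,
  where \<open>v = (x, y)\<close>, the matrices \<open>A\<close>, \<open>B\<close> are positive diagonal and \<open>W\<close> is real. Pairing with
  \<open>x\<close> and \<open>y\<close> and writing \<open>X = x\<^sup>* A x\<close>, \<open>Y = y\<^sup>* B y\<close> gives \<open>(t - 1) Y = t (cnj t - 1) X\<close>, that is,
  \<open>t (X + Y) = \<bar>t\<bar>\<^sup>2 X + Y\<close>, which makes \<open>t\<close> real and positive.\<close>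

lemma bipartite_kernel_positive_real:
  fixes t :: complex and b :: "'i \<Rightarrow> real" and w :: "'i \<Rightarrow> 'i \<Rightarrow> real" and v :: "'i \<Rightarrow> complex"
  assumes fin: "finite I" "finite J"
    and pos: "\<And>i. i \<in> I \<union> J \<Longrightarrow> b i > 0"
    and rowI: "\<And>i. i \<in> I \<Longrightarrow> (t - 1) * b i * v i = (\<Sum>j\<in>J. w i j * v j)"
    and rowJ: "\<And>j. j \<in> J \<Longrightarrow> (t - 1) * b j * v j = t * (\<Sum>i\<in>I. w i j * v i)"
    and nz: "k \<in> I \<union> J" "v k \<noteq> 0"
  shows "t \<in> \<real> \<and> Re t > 0"
\<comment> \<open>The value \<open>t = 1\<close> is itself real and positive. Otherwise
  \<open>t - 1\<close> can be cancelled, which is needed below to pass from \<open>X > 0\<close> to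
  \<open>Z \<noteq> 0\<close>.\<close>
proof (cases "t = 1")
  case False
  define X where "X = (\<Sum>i\<in>I. b i * (cmod (v i))\<^sup>2)"
  define Y where "Y = (\<Sum>j\<in>J. b j * (cmod (v j))\<^sup>2)"
  define Z where "Z = (\<Sum>i\<in>I. \<Sum>j\<in>J. w i j * v j * cnj (v i))"
  have sq: "complex_of_real (c * (cmod z)\<^sup>2) = c * z * cnj z" for c z
    by (simp add: complex_norm_square flip: of_real_power)
  have X: "(t - 1) * X = Z"
  proof -
    have "(t - 1) * X = (\<Sum>i\<in>I. (t - 1) * b i * v i * cnj (v i))"
      unfolding X_def of_real_sum sq by (simp add: sum_distrib_left mult.assoc)
    also have "\<dots> = Z" unfolding Z_def by (simp add: rowI sum_distrib_right)
    finally show ?thesis .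
  qed
  \<comment> \<open>Since \<open>w\<close> is real, exchanging the two sums turns the pairing with
    \<open>v\<close> on \<open>J\<close> into the conjugate of \<open>Z\<close>.\<close>
  have Y: "(t - 1) * Y = t * cnj Z"
  proof -
    have "(t - 1) * Y = (\<Sum>j\<in>J. (t - 1) * b j * v j * cnj (v j))"
      unfolding Y_def of_real_sum sq by (simp add: sum_distrib_left mult.assoc)
    also have "\<dots> = (\<Sum>j\<in>J. t * (\<Sum>i\<in>I. w i j * v i) * cnj (v j))"
      by (simp add: rowJ)
    also have "\<dots> = t * (\<Sum>j\<in>J. \<Sum>i\<in>I. w i j * v i * cnj (v j))"
      by (simp add: sum_distrib_right sum_distrib_left mult.assoc)
    also have "\<dots> = t * cnj Z" unfolding Z_def
      by (subst sum.swap) (simp add: mult_ac)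
    finally show ?thesis .
  qed
  have nonneg: "X \<ge> 0" "Y \<ge> 0"
    unfolding X_def Y_def using pos by (auto intro!: sum_nonneg simp: less_imp_le)
  have "X > 0 \<or> Y > 0"
  proof -
    have kpos: "b k * (cmod (v k))\<^sup>2 > 0" using nz pos by simp
    show ?thesis
    proof (cases "k \<in> I")
      case True
      then have "b k * (cmod (v k))\<^sup>2 \<le> X"
        unfolding X_def using fin pos by (intro member_le_sum) (auto simp: less_imp_le)
      with kpos show ?thesis by simp
    next
      case False
      then have "b k * (cmod (v k))\<^sup>2 \<le> Y"
        unfolding Y_def using fin pos nz by (intro member_le_sum) (auto simp: less_imp_le)
      with kpos show ?thesis by simp
    qed
  qed
  \<comment> \<open>As \<open>t = 0\<close> is not yet excluded, positivity of \<bar>t\<bar>^2 X + Y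
    has to come from \<open>Y\<close>. If \<open>Y = 0\<close>, then \<open>X > 0\<close> makes
    \<open>Z\<close> nonzero, so \<open>t = 0\<close>; but then \<open>rowJ\<close> kills
    \<open>v\<close> on \<open>J\<close>, and with it \<open>Z\<close>.\<close>
  moreover have "Y > 0"
  proof (rule ccontr)
    assume "\<not> Y > 0"
    with nonneg have "Y = 0" by simp
    then have "t = 0 \<or> Z = 0" using Y by simp
    moreover have "Z \<noteq> 0" using X False \<open>Y = 0\<close> \<open>X > 0 \<or> Y > 0\<close> by auto
    ultimately have "t = 0" by simp
    then have "v j = 0" if "j \<in> J" for j using rowJ[OF that] pos[of j] that by auto
    then have "Z = 0" unfolding Z_def by simp
    with \<open>Z \<noteq> 0\<close> show False ..
  qed
  ultimately have S: "X + Y > 0" using nonneg by simp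
  \<comment> \<open>\<open>Z\<close> is eliminated by conjugating the first identity,
    \<open>X\<close> being real.\<close>
  have "(t - 1) * Y = t * ((cnj t - 1) * X)"
    unfolding Y X[symmetric] by simp
  then have "t * (X + Y) = t * cnj t * X + Y" by (simp add: algebra_simps)
  also have "\<dots> = complex_of_real ((cmod t)\<^sup>2 * X + Y)"
    by (simp add: complex_norm_square flip: of_real_power)
  finally have "t = complex_of_real (((cmod t)\<^sup>2 * X + Y) / (X + Y))"
    using S by (simp add: field_simps flip: of_real_add)
  moreover have "((cmod t)\<^sup>2 * X + Y) / (X + Y) > 0"
    using S nonneg \<open>Y > 0\<close> by (intro divide_pos_pos add_nonneg_pos) auto
  ultimately show ?thesis by (metis Reals_of_real Re_complex_of_real)
qed auto

text \<open>This lets one global sign, that of the first entry, turn the whole diagonal into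
  absolute values.\<close>

lemma alternating_sgn:
  fixes a :: "int list"
  assumes "\<And>i. Suc i < length a \<Longrightarrow> a ! i * a ! Suc i < 0" "k < length a"
  shows "sgn (a ! k) = (if even k then sgn (a ! 0) else - sgn (a ! 0))"
  using assms(2)
proof (induction k)
  case (Suc k)
  then have "a ! k * a ! Suc k < 0" using assms(1) by simp
  then have "sgn (a ! Suc k) = - sgn (a ! k)" by (auto simp: mult_less_0_iff)
  with Suc show ?case by simp
qed simp

text \<open>Evaluation at \<open>\<alpha>\<close> is a ring homomorphism and so commutes with the
  determinant; a root therefore makes a complex matrix singular. The kernel vector is returned as a
  function so that its sums can be split by parity.\<close>

lemma seifert_alexander_kernel:
  fixes \<alpha> :: complex
  assumes root: "poly (map_poly of_int (seifert_alexander U)) \<alpha> = 0" and U: "U \<in> carrier_mat n n"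
  obtains v k where "k < n" "v k \<noteq> 0"
    "\<And>i. i < n \<Longrightarrow> (\<Sum>j<n. (\<alpha> * of_int (U $$ (i, j)) - of_int (U $$ (j, i))) * v j) = 0"
proof -
  let ?h = "\<lambda>p :: int poly. poly (map_poly of_int p) \<alpha>"
  interpret h: comm_ring_hom ?h
    by standard (simp_all add: hom_distribs)
  define M where "M = mat n n (\<lambda>(i, j). \<alpha> * of_int (U $$ (i, j)) - of_int (U $$ (j, i)))"
  let ?V = "map_mat (\<lambda>c. [:c:]) U"
  have "map_mat ?h ([:0, 1:] \<cdot>\<^sub>m ?V - transpose_mat ?V) = M"
    using U unfolding M_def by (intro eq_matI) (auto simp: of_int_hom.map_poly_pCons_hom)
  then have "det M = ?h (seifert_alexander U)"
    unfolding seifert_alexander_def Let_def by (metis h.hom_det)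
  then have "det M = 0" using root by simp
  moreover have M: "M \<in> carrier_mat n n" unfolding M_def by simp
  ultimately obtain u where u: "u \<in> carrier_vec n" "u \<noteq> 0\<^sub>v n" "M *\<^sub>v u = 0\<^sub>v n"
    using det_0_iff_vec_prod_zero by blast
  then obtain k where k: "k < n" "u $ k \<noteq> 0" by (metis carrier_vecD eq_vecI index_zero_vec)
  have "(\<Sum>j<n. (\<alpha> * of_int (U $$ (i, j)) - of_int (U $$ (j, i))) * u $ j) = 0" if "i < n" for i
  proof -
    have "(M *\<^sub>v u) $ i = 0" using u that by simp
    then show ?thesis using that u M
      by (simp add: M_def scalar_prod_def atLeast0LessThan)
  qed
  with k show ?thesis by (rule that)
qed

lemma alternating_seifert_alexander_root:
  fixes \<alpha> :: complex
  assumes nz: "0 \<notin> set a" and alt: "\<And>i. Suc i < length a \<Longrightarrow> a ! i * a ! Suc i < 0"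
    and root: "poly (map_poly of_int (seifert_alexander (seifert_matrix a))) \<alpha> = 0"
  shows "\<alpha> \<in> \<real> \<and> Re \<alpha> > 0"
proof -
  define n where "n = length a"
  define U where "U = seifert_matrix a"
  have U: "U \<in> carrier_mat n n" unfolding U_def seifert_matrix_def n_def by simp
  obtain v k where k: "k < n" "v k \<noteq> 0"
    and ker: "\<And>i. i < n \<Longrightarrow> (\<Sum>j<n. (\<alpha> * of_int (U $$ (i, j)) - of_int (U $$ (j, i))) * v j) = 0"
    using seifert_alexander_kernel[OF root[folded U_def] U] by blast
  \<comment> \<open>Indices start at 0 here, so \<open>J\<close> holds the even-numbered rows of the
    Seifert matrix, the only ones with off-diagonal entries.\<close>
  define I where "I = {i. i < n \<and> even i}"
  define J where "J = {i. i < n \<and> odd i}"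
  have IJ: "{..<n} = I \<union> J" "I \<inter> J = {}" "finite I" "finite J" unfolding I_def J_def by auto
  have ent: "U $$ (i, j) = seifert_entry a (Suc i) (Suc j)" if "i < n" "j < n" for i j
    using that unfolding U_def seifert_matrix_def n_def by simp
  \<comment> \<open>Off-diagonal entries join neighbouring indices, which differ in parity.\<close>
  have same: "U $$ (i, j) = (if i = j then a ! i else 0)" if "i < n" "j < n" "even i = even j" for i j
  proof -
    have "Suc j \<noteq> i" "j \<noteq> Suc i" using that(3) by presburger+
    then show ?thesis unfolding ent[OF that(1,2)] seifert_entry_def by simp
  qed
  have zero: "U $$ (i, j) = 0" if "i \<in> I" "j \<in> J" for i j
    using that by (auto simp: ent seifert_entry_def I_def J_def)
  define s where "s = sgn (a ! 0)"
  have abs: "\<bar>a ! i\<bar> = (if even i then s * a ! i else - s * a ! i)" if "i < n" for i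
    using alternating_sgn[OF alt, of i] that unfolding s_def n_def by (simp add: abs_sgn mult.commute)
  show ?thesis
  \<comment> \<open>The instance has \<open>b i\<close> = \<open>\<bar>a ! i\<bar>\<close> and
    \<open>w i j\<close> = \<open>s * U $$ (j, i)\<close>. By \<open>zero\<close>, only the
    \<open>U\<^sup>T\<close> part couples a row in \<open>I\<close> to \<open>J\<close>, and only
    the \<open>\<alpha> U\<close> part couples a row in \<open>J\<close> to
    \<open>I\<close>.\<close>
  proof (rule bipartite_kernel_positive_real)
    show "finite I" "finite J" by fact+
    show "k \<in> I \<union> J" "v k \<noteq> 0" using k IJ by auto
    show "0 < real_of_int \<bar>a ! i\<bar>" if "i \<in> I \<union> J" for i
      using that nz unfolding IJ(1)[symmetric] n_def by (auto dest: nth_mem)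
    show "(\<alpha> - 1) * real_of_int \<bar>a ! i\<bar> * v i = (\<Sum>j\<in>J. real_of_int (s * U $$ (j, i)) * v j)"
      if "i \<in> I" for i
    proof -
      have i: "i < n" "even i" using that unfolding I_def by auto
      have "0 = (\<Sum>j\<in>I. (\<alpha> * of_int (U $$ (i, j)) - of_int (U $$ (j, i))) * v j)
          + (\<Sum>j\<in>J. (\<alpha> * of_int (U $$ (i, j)) - of_int (U $$ (j, i))) * v j)"
        using ker[OF i(1)] IJ by (simp add: sum.union_disjoint)
      also have "(\<Sum>j\<in>I. (\<alpha> * of_int (U $$ (i, j)) - of_int (U $$ (j, i))) * v j)
          = (\<Sum>j\<in>I. if j = i then (\<alpha> - 1) * of_int (a ! i) * v i else 0)"
        using i by (intro sum.cong) (auto simp: same I_def algebra_simps)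
      also have "\<dots> = (\<alpha> - 1) * of_int (a ! i) * v i" using that IJ by simp
      also have "(\<Sum>j\<in>J. (\<alpha> * of_int (U $$ (i, j)) - of_int (U $$ (j, i))) * v j)
          = - (\<Sum>j\<in>J. of_int (U $$ (j, i)) * v j)"
        using that by (simp add: zero sum_negf)
      finally have "(\<alpha> - 1) * of_int (a ! i) * v i = (\<Sum>j\<in>J. of_int (U $$ (j, i)) * v j)" by simp
      then have "of_int s * ((\<alpha> - 1) * of_int (a ! i) * v i)
          = of_int s * (\<Sum>j\<in>J. of_int (U $$ (j, i)) * v j)" by simp
      then show ?thesis using i by (simp add: abs sum_distrib_left mult_ac del: of_int_abs)
    qed
    show "(\<alpha> - 1) * real_of_int \<bar>a ! j\<bar> * v j = \<alpha> * (\<Sum>i\<in>I. real_of_int (s * U $$ (j, i)) * v i)"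
      if "j \<in> J" for j
    proof -
      have j: "j < n" "odd j" using that unfolding J_def by auto
      have "0 = (\<Sum>i\<in>I. (\<alpha> * of_int (U $$ (j, i)) - of_int (U $$ (i, j))) * v i)
          + (\<Sum>i\<in>J. (\<alpha> * of_int (U $$ (j, i)) - of_int (U $$ (i, j))) * v i)"
        using ker[OF j(1)] IJ by (simp add: sum.union_disjoint)
      also have "(\<Sum>i\<in>J. (\<alpha> * of_int (U $$ (j, i)) - of_int (U $$ (i, j))) * v i)
          = (\<Sum>i\<in>J. if i = j then (\<alpha> - 1) * of_int (a ! j) * v j else 0)"
        using j by (intro sum.cong) (auto simp: same J_def algebra_simps)
      also have "\<dots> = (\<alpha> - 1) * of_int (a ! j) * v j" using that IJ by simp
      also have "(\<Sum>i\<in>I. (\<alpha> * of_int (U $$ (j, i)) - of_int (U $$ (i, j))) * v i)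
          = \<alpha> * (\<Sum>i\<in>I. of_int (U $$ (j, i)) * v i)"
        using that by (simp add: zero sum_distrib_left mult.assoc)
      finally have "(\<alpha> - 1) * of_int (a ! j) * v j = - \<alpha> * (\<Sum>i\<in>I. of_int (U $$ (j, i)) * v i)"
        by (simp add: eq_neg_iff_add_eq_0 add.commute)
      \<comment> \<open>Rows in \<open>I\<close> were multiplied by \<open>s\<close>, these by
        \<open>- s\<close>. The extra sign makes the diagonal entry positive and also cancels the
        minus before \<open>\<alpha>\<close>, so both families share the same
        \<open>w\<close>.\<close>
      then have "- of_int s * ((\<alpha> - 1) * of_int (a ! j) * v j)
          = of_int s * (\<alpha> * (\<Sum>i\<in>I. of_int (U $$ (j, i)) * v i))" by simp
      then show ?thesis using j by (simp add: abs sum_distrib_left mult_ac del: of_int_abs)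
    qed
  qed
qed

theorem theorem2:
  fixes m :: nat and a :: "int list" and r :: rat
  assumes "m \<ge> 1" and "length a = m"
    and "\<forall>i<m. a ! i \<noteq> 0"
    and "r = even_ncf a"
    and "\<forall>i. i + 1 < m \<longrightarrow> a ! i * a ! (i + 1) < 0"
  shows "\<forall>\<alpha>::complex. poly (map_poly of_int (two_bridge_alexander r)) \<alpha> = 0 \<longrightarrow>
           (\<alpha> \<in> \<real> \<and> Re \<alpha> > 0) \<and> Re \<alpha> > -1"
proof -
  have nz: "0 \<notin> set a" using assms(2,3) by (auto simp: in_set_conv_nth)
  \<comment> \<open>Even expansions are unique, so the polynomial attached to \<open>r\<close> is
    the one computed from the given \<open>a\<close>.\<close>
  then have "is_even_expansion a r" using assms(1,2,4) unfolding is_even_expansion_def by auto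
  then have "two_bridge_alexander r = seifert_alexander (seifert_matrix a)"
    unfolding two_bridge_alexander_def by (simp add: even_expansion_eq)
  moreover have "\<And>i. Suc i < length a \<Longrightarrow> a ! i * a ! Suc i < 0" using assms(2,5) by simp
  ultimately show ?thesis using alternating_seifert_alexander_root[OF nz] by fastforce
qed

end
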